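(* Let $\mathfrak g$ be a finite-dimensional complex simple Lie algebra with root system $\Phi$, base $\Pi=\{\alpha_1,\dots,\alpha_n\}$ and Weyl group $W$, and let $\lambda$ be a dominant integral weight. Let $\mathbf P$ be the weight polytope of $\lambda$. Then the set of orbits of the nonempty faces of $\mathbf P$ under the action of $W$ is in bijection with the set of connected subdiagrams of the extended Dynkin diagram that contain the extended node $\{-\lambda\}$.
   Context: Let $E$ be the real span of $\Pi$, equipped with the $W$-invariant inner product $(\cdot,\cdot)$; weights are regarded as elements of $E$. The weight polytope of $\lambda$ is $\mathbf P=\mathrm{conv}(W\lambda)$, the convex hull of the $W$-orbit of $\lambda$ (equivalently, the convex hull of the set of weights of the irreducible highest weight module of highest weight $\lambda$). $W$ acts on the set of faces of $\mathbf P$. The extended Dynkin diagram is the graph obtained from the Dynkin diagram of $\Pi$ (vertices $\alpha_1,\dots,\alpha_n$ with the usual edges) by adding a new node $\{-\lambda\}$ and drawing a single edge between $\{-\lambda\}$ and $\alpha_i$ if and only if $(\lambda,\alpha_i)>0$. A subdiagram means the induced subdiagram on a subset of the vertices. *)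

theory Defs
  imports "HOL-Analysis.Analysis"
begin

text \<open>Root systems are modelled abstractly in a Euclidean space 'a; the inner product
of 'a plays the role of the W-invariant inner product on E (reflections are orthogonal).\<close>

definition reflection :: "'a::euclidean_space \<Rightarrow> 'a \<Rightarrow> 'a" where
  "reflection a x = x - (2 * (x \<bullet> a) / (a \<bullet> a)) *\<^sub>R a"

definition root_system :: "'a::euclidean_space set \<Rightarrow> bool" where
  "root_system \<Phi> \<longleftrightarrow>
     finite \<Phi> \<and> 0 \<notin> \<Phi> \<and> span \<Phi> = UNIV \<and>
     (\<forall>a\<in>\<Phi>. reflection a ` \<Phi> = \<Phi>) \<and>
     (\<forall>a\<in>\<Phi>. \<forall>b\<in>\<Phi>. 2 * (a \<bullet> b) / (b \<bullet> b) \<in> \<int>) \<and>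
     (\<forall>a\<in>\<Phi>. \<forall>c::real. c *\<^sub>R a \<in> \<Phi> \<longrightarrow> c = 1 \<or> c = -1)"

definition irreducible_root_system :: "'a::euclidean_space set \<Rightarrow> bool" where
  "irreducible_root_system \<Phi> \<longleftrightarrow> root_system \<Phi> \<and>
     \<not> (\<exists>\<Phi>1 \<Phi>2. \<Phi>1 \<noteq> {} \<and> \<Phi>2 \<noteq> {} \<and> \<Phi>1 \<union> \<Phi>2 = \<Phi> \<and>
            (\<forall>a\<in>\<Phi>1. \<forall>b\<in>\<Phi>2. a \<bullet> b = 0))"

definition is_base :: "'a::euclidean_space set \<Rightarrow> 'a set \<Rightarrow> bool" where
  "is_base \<Phi> \<Delta> \<longleftrightarrow> \<Delta> \<subseteq> \<Phi> \<and> independent \<Delta> \<and>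
     (\<forall>\<beta>\<in>\<Phi>. \<exists>c::'a \<Rightarrow> real. \<beta> = (\<Sum>\<alpha>\<in>\<Delta>. c \<alpha> *\<^sub>R \<alpha>) \<and> (\<forall>\<alpha>\<in>\<Delta>. c \<alpha> \<in> \<int>) \<and>
        ((\<forall>\<alpha>\<in>\<Delta>. c \<alpha> \<ge> 0) \<or> (\<forall>\<alpha>\<in>\<Delta>. c \<alpha> \<le> 0)))"

inductive_set weyl_group :: "'a::euclidean_space set \<Rightarrow> ('a \<Rightarrow> 'a) set" for \<Phi> where
  id_in: "id \<in> weyl_group \<Phi>"
| refl_comp: "w \<in> weyl_group \<Phi> \<Longrightarrow> a \<in> \<Phi> \<Longrightarrow> reflection a \<circ> w \<in> weyl_group \<Phi>"

definition dominant_integral :: "'a::euclidean_space set \<Rightarrow> 'a \<Rightarrow> bool" where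
  "dominant_integral \<Delta> lam \<longleftrightarrow> (\<forall>\<alpha>\<in>\<Delta>. 2 * (lam \<bullet> \<alpha>) / (\<alpha> \<bullet> \<alpha>) \<in> \<nat>)"

definition weight_polytope :: "'a::euclidean_space set \<Rightarrow> 'a \<Rightarrow> 'a set" where
  "weight_polytope \<Phi> lam = convex hull {w lam | w. w \<in> weyl_group \<Phi>}"

definition face_orbits :: "'a::euclidean_space set \<Rightarrow> 'a \<Rightarrow> 'a set set set" where
  "face_orbits \<Phi> lam =
     {{w ` F | w. w \<in> weyl_group \<Phi>} | F. F face_of weight_polytope \<Phi> lam \<and> F \<noteq> {}}"

text \<open>Extended Dynkin diagram: vertices are None (the extended node {-\<lambda>}) and Some \<alpha>
for \<alpha> in \<Delta>. Two simple roots are adjacent iff they are distinct and non-orthogonal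
(edge multiplicities are irrelevant for connectivity); None is adjacent to Some \<alpha> iff
(lam,\<alpha>) > 0.\<close>
definition ext_vertices :: "'a set \<Rightarrow> 'a option set" where
  "ext_vertices \<Delta> = insert None (Some ` \<Delta>)"

fun ext_adj :: "'a::euclidean_space \<Rightarrow> 'a option \<Rightarrow> 'a option \<Rightarrow> bool" where
  "ext_adj lam None None = False"
| "ext_adj lam None (Some \<alpha>) = (lam \<bullet> \<alpha> > 0)"
| "ext_adj lam (Some \<alpha>) None = (lam \<bullet> \<alpha> > 0)"
| "ext_adj lam (Some \<alpha>) (Some \<beta>) = (\<alpha> \<noteq> \<beta> \<and> \<alpha> \<bullet> \<beta> \<noteq> 0)"

definition connected_subdiagram :: "'a::euclidean_space \<Rightarrow> 'a option set \<Rightarrow> bool" where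
  "connected_subdiagram lam S \<longleftrightarrow> S \<noteq> {} \<and>
     (\<forall>x\<in>S. \<forall>y\<in>S. (%u v. u \<in> S \<and> v \<in> S \<and> ext_adj lam u v)\<^sup>*\<^sup>* x y)"

definition ext_subdiagrams :: "'a::euclidean_space set \<Rightarrow> 'a \<Rightarrow> 'a option set set" where
  "ext_subdiagrams \<Delta> lam =
     {S. S \<subseteq> ext_vertices \<Delta> \<and> None \<in> S \<and> connected_subdiagram lam S}"

end

theory Submission
  imports Defs
begin

text \<open>A face of \<open>P\<close> is cut out by a linear functional, which a Weyl group element makes dominant.
All points of \<open>P\<close> lie below the weight \<open>lam\<close> in the cone order of the simple roots, so the face is
then \<open>face J\<close>: the points \<open>x\<close> for which \<open>lam - x\<close> has no component along the simple roots outside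
\<open>J\<close>, where \<open>J\<close> is the set of simple roots killed by the functional. Only the connected component of
the extended node in \<open>J\<close> matters: climbing from an orbit point of the face to \<open>lam\<close> by simple
reflections uses only roots of that component. Conversely, for connected \<open>J\<close> the sum of the orbit
points in \<open>face J\<close> is dominant, hence depends only on the Weyl orbit of the face (a Weyl orbit has
just one dominant point), and the support of its deficit from a multiple of \<open>lam\<close> is \<open>J\<close>.\<close>

section \<open>Reflections and the Weyl group\<close>

lemma linear_reflection: "linear (reflection a)"
  by (rule linearI) (simp_all add: reflection_def inner_add_left scaleR_add_left scaleR_add_right
      add_divide_distrib distrib_left algebra_simps)

lemma reflection_reflection [simp]: "reflection a (reflection a x) = x"
  by (cases "a = 0") (simp_all add: reflection_def inner_diff_left field_simps)

lemma orthogonal_transformation_reflection: "orthogonal_transformation (reflection a)"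
proof -
  have "reflection a x \<bullet> reflection a y = x \<bullet> y" for x y
    by (cases "a = 0") (simp_all add: reflection_def inner_diff_left inner_diff_right inner_commute
        field_simps)
  then show ?thesis
    by (simp add: orthogonal_transformation_def linear_reflection)
qed

lemma reflection_conj:
  assumes "orthogonal_transformation f"
  shows "f (reflection a x) = reflection (f a) (f x)"
  using assms linear_diff[of f] linear_cmul[of f]
  by (simp add: orthogonal_transformation_def reflection_def)

lemma reflection_inner_swap: "reflection a x \<bullet> y = x \<bullet> reflection a y"
  by (metis orthogonal_transformation_def orthogonal_transformation_reflection
      reflection_reflection)

lemma reflection_self [simp]: "reflection a a = - a"
  by (cases "a = 0") (simp_all add: reflection_def algebra_simps flip: scaleR_2)

lemma reflection_minus [simp]: "reflection (- a) = reflection a"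
  by (rule ext) (simp add: reflection_def)

lemma orthogonal_transformation_foldr_reflection:
  "orthogonal_transformation (foldr reflection as)"
proof (induction as)
  case Nil
  then show ?case by (simp add: id_def)
next
  case (Cons a as)
  then show ?case
    using orthogonal_transformation_compose[OF orthogonal_transformation_reflection]
    by (simp add: comp_def)
qed

lemma weyl_group_orthogonal: "w \<in> weyl_group \<Phi> \<Longrightarrow> orthogonal_transformation w"
  by (induction rule: weyl_group.induct)
    (simp_all add: id_def orthogonal_transformation_compose[OF orthogonal_transformation_reflection,
        unfolded comp_def] comp_def)

lemma weyl_group_comp: "u \<in> weyl_group \<Phi> \<Longrightarrow> v \<in> weyl_group \<Phi> \<Longrightarrow> u \<circ> v \<in> weyl_group \<Phi>"
  by (induction rule: weyl_group.induct) (auto simp: comp_assoc intro: weyl_group.intros)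

lemma reflection_in_weyl_group: "a \<in> \<Phi> \<Longrightarrow> reflection a \<in> weyl_group \<Phi>"
  using weyl_group.refl_comp[OF weyl_group.id_in, of a \<Phi>] by simp

lemma weyl_group_inverse:
  "w \<in> weyl_group \<Phi> \<Longrightarrow> \<exists>v\<in>weyl_group \<Phi>. v \<circ> w = id \<and> w \<circ> v = id"
proof (induction rule: weyl_group.induct)
  case id_in
  show ?case by (intro bexI[of _ id]) (simp_all add: weyl_group.id_in)
next
  case (refl_comp w a)
  then obtain v where v: "v \<in> weyl_group \<Phi>" "v \<circ> w = id" "w \<circ> v = id" by blast
  have "(v \<circ> reflection a) \<circ> (reflection a \<circ> w) = id" "(reflection a \<circ> w) \<circ> (v \<circ> reflection a) = id"
    using v(2,3) by (auto simp: fun_eq_iff)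
  then show ?case
    using weyl_group_comp[OF v(1) reflection_in_weyl_group[OF refl_comp(2)]] by blast
qed

lemma is_base_span:
  assumes "root_system \<Phi>" "is_base \<Phi> \<Delta>"
  shows "span \<Delta> = UNIV"
proof -
  have "\<Phi> \<subseteq> span \<Delta>"
    using assms(2) unfolding is_base_def
    by (metis (no_types, lifting) span_base span_scale span_sum subsetI)
  then show ?thesis
    using assms(1) unfolding root_system_def
    by (metis span_minimal subspace_span top.extremum_uniqueI)
qed

section \<open>Simple roots and uniqueness of dominant points\<close>

text \<open>Each coefficient functional of the basis is linear; its adjoint at 1 is the vector
  representing it through the inner product.\<close>

lemma dual_basis_exists:
  fixes B :: "'a::euclidean_space set"
  assumes "independent B" "span B = UNIV"
  obtains \<omega> where "\<And>a b. a \<in> B \<Longrightarrow> b \<in> B \<Longrightarrow> \<omega> a \<bullet> b = (if a = b then 1 else 0)"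
proof -
  define \<omega> where "\<omega> a = adjoint (\<lambda>v. representation B v a) 1" for a
  have lin: "linear (\<lambda>v. representation B v a)" for a
    using assms
    by (intro linearI) (simp_all add: representation_add representation_scale)
  have "\<omega> a \<bullet> b = (if a = b then 1 else 0)" if "b \<in> B" for a b
    using that assms adjoint_works[OF lin[of a], of b 1]
    by (simp add: \<omega>_def inner_commute representation_basis)
  then show ?thesis using that by blast
qed

text \<open>With the dual basis \<open>\<omega>\<close> as a parameter, the coefficient of
  \<open>v\<close> at a simple root \<open>a\<close> is just \<open>\<omega> a \<bullet> v\<close>.
  Up to positive scaling the \<open>\<omega> a\<close> are the fundamental weights.\<close>

locale based_root_system =
  fixes \<Phi> \<Delta> :: "'a::euclidean_space set" and \<omega> :: "'a \<Rightarrow> 'a"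
  assumes roots: "root_system \<Phi>" and base: "is_base \<Phi> \<Delta>"
    and dual: "\<And>a b. a \<in> \<Delta> \<Longrightarrow> b \<in> \<Delta> \<Longrightarrow> \<omega> a \<bullet> b = (if a = b then 1 else 0)"
begin

lemma finite_roots: "finite \<Phi>" and root_nonzero: "a \<in> \<Phi> \<Longrightarrow> a \<noteq> 0"
  and span_roots: "span \<Phi> = UNIV" and reflection_roots: "a \<in> \<Phi> \<Longrightarrow> reflection a ` \<Phi> = \<Phi>"
  and reduced: "a \<in> \<Phi> \<Longrightarrow> c *\<^sub>R a \<in> \<Phi> \<Longrightarrow> c = 1 \<or> c = -1"
  using roots unfolding root_system_def by auto

lemma base_subset: "\<Delta> \<subseteq> \<Phi>"
  using base unfolding is_base_def by auto

lemma finite_base: "finite \<Delta>"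
  using base_subset finite_roots finite_subset by blast

lemma span_base: "span \<Delta> = UNIV"
  using is_base_span roots base by blast

lemma dual_sum: "a \<in> \<Delta> \<Longrightarrow> \<omega> a \<bullet> (\<Sum>b\<in>\<Delta>. c b *\<^sub>R b) = c a"
proof -
  assume a: "a \<in> \<Delta>"
  have "\<omega> a \<bullet> (\<Sum>b\<in>\<Delta>. c b *\<^sub>R b) = (\<Sum>b\<in>\<Delta>. if a = b then c b else 0)"
    by (simp add: inner_sum_right) (rule sum.cong, simp_all add: dual a)
  then show ?thesis using a finite_base by simp
qed

lemma dual_expansion: "v = (\<Sum>a\<in>\<Delta>. (\<omega> a \<bullet> v) *\<^sub>R a)"
proof -
  have "v \<in> span \<Delta>" by (simp add: span_base)
  then obtain c where c: "v = (\<Sum>a\<in>\<Delta>. c a *\<^sub>R a)"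
    using span_finite[OF finite_base] by auto
  have "(\<Sum>a\<in>\<Delta>. (\<omega> a \<bullet> v) *\<^sub>R a) = (\<Sum>a\<in>\<Delta>. c a *\<^sub>R a)"
    by (rule sum.cong) (simp_all add: c dual_sum)
  then show ?thesis using c by simp
qed

lemma inner_expansion: "v \<bullet> x = (\<Sum>a\<in>\<Delta>. (\<omega> a \<bullet> v) * (a \<bullet> x))"
  by (subst dual_expansion) (simp add: inner_sum_left)

text \<open>The real cone spanned by the simple roots; \<open>nonneg (x - y)\<close> is the
  dominance order without its lattice condition.\<close>

definition nonneg :: "'a \<Rightarrow> bool" where
  "nonneg v \<longleftrightarrow> (\<forall>a\<in>\<Delta>. 0 \<le> \<omega> a \<bullet> v)"

definition dominant :: "'a \<Rightarrow> bool" where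
  "dominant v \<longleftrightarrow> (\<forall>a\<in>\<Delta>. 0 \<le> a \<bullet> v)"

lemma nonneg_inner_dominant: "nonneg u \<Longrightarrow> dominant v \<Longrightarrow> 0 \<le> u \<bullet> v"
  by (subst inner_expansion) (auto simp: nonneg_def dominant_def intro!: sum_nonneg)

lemma nonneg_base: "a \<in> \<Delta> \<Longrightarrow> nonneg a"
  by (simp add: nonneg_def dual)

lemma root_nonneg_cases: "b \<in> \<Phi> \<Longrightarrow> nonneg b \<or> nonneg (- b)"
proof -
  assume "b \<in> \<Phi>"
  then obtain c where "b = (\<Sum>a\<in>\<Delta>. c a *\<^sub>R a)" "(\<forall>a\<in>\<Delta>. c a \<ge> 0) \<or> (\<forall>a\<in>\<Delta>. c a \<le> 0)"
    using base unfolding is_base_def by blast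
  then show ?thesis by (auto simp: nonneg_def dual_sum)
qed

lemma reflection_root: "a \<in> \<Phi> \<Longrightarrow> b \<in> \<Phi> \<Longrightarrow> reflection a b \<in> \<Phi>"
  using reflection_roots by blast

text \<open>Otherwise reflecting \<open>a\<close> in \<open>b\<close> keeps the coefficient 1 at
  \<open>a\<close> and creates a negative one at \<open>b\<close>, but a root never has coefficients
  of mixed sign.\<close>

lemma base_obtuse:
  assumes "a \<in> \<Delta>" "b \<in> \<Delta>" "a \<noteq> b"
  shows "a \<bullet> b \<le> 0"
proof (rule ccontr)
  assume pos: "\<not> a \<bullet> b \<le> 0"
  have "b \<bullet> b > 0" using root_nonzero base_subset assms by auto
  then have "\<omega> b \<bullet> reflection b a < 0" "\<omega> a \<bullet> reflection b a > 0"
    using assms pos by (simp_all add: reflection_def inner_diff_right dual)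
  moreover have "nonneg (reflection b a) \<or> nonneg (- reflection b a)"
    using assms base_subset by (intro root_nonneg_cases reflection_root) auto
  ultimately show False using assms unfolding nonneg_def by force
qed

lemma nonneg_antisym:
  assumes "nonneg v" "nonneg (- v)"
  shows "v = 0"
  using assms by (subst dual_expansion, intro sum.neutral) (force simp: nonneg_def)

text \<open>As the root system is reduced, \<open>b\<close> has a positive coefficient at some
  simple root other than \<open>a\<close>. The reflection changes only the coefficient at
  \<open>a\<close>, so that one survives and decides the sign of the image.\<close>

lemma simple_reflection_nonneg:
  assumes "a \<in> \<Delta>" "b \<in> \<Phi>" "nonneg b" "b \<noteq> a"
  shows "nonneg (reflection a b)"
proof -
  have "\<exists>c\<in>\<Delta>. c \<noteq> a \<and> \<omega> c \<bullet> b \<noteq> 0"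
  proof (rule ccontr)
    assume "\<not> ?thesis"
    then have "(\<Sum>c\<in>\<Delta>. (\<omega> c \<bullet> b) *\<^sub>R c) = (\<Sum>c\<in>\<Delta>. if c = a then (\<omega> a \<bullet> b) *\<^sub>R a else 0)"
      by (intro sum.cong) auto
    then have b: "b = (\<omega> a \<bullet> b) *\<^sub>R a"
      using dual_expansion[of b] assms(1) finite_base by simp
    then have "\<omega> a \<bullet> b = 1 \<or> \<omega> a \<bullet> b = -1"
      using reduced[of a "\<omega> a \<bullet> b"] assms base_subset by auto
    then show False using b assms(1,3,4) by (force simp: nonneg_def)
  qed
  then obtain c where c: "c \<in> \<Delta>" "c \<noteq> a" "\<omega> c \<bullet> b > 0"
    using assms(3) unfolding nonneg_def by force
  then have "\<omega> c \<bullet> reflection a b > 0"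
    using assms by (simp add: reflection_def inner_diff_right dual)
  moreover have "nonneg (reflection a b) \<or> nonneg (- reflection a b)"
    using assms base_subset by (intro root_nonneg_cases reflection_root) auto
  ultimately show ?thesis using c(1) unfolding nonneg_def by force
qed

lemma foldr_reflection_root: "set as \<subseteq> \<Delta> \<Longrightarrow> b \<in> \<Phi> \<Longrightarrow> foldr reflection as b \<in> \<Phi>"
  using base_subset by (induction as) (auto intro: reflection_root)

text \<open>Exchange condition: if applying the word letter by letter turns \<open>a\<close> negative, it does so at a
letter \<open>c\<close> equal to the current image of \<open>a\<close>, as \<open>c\<close> is the only positive root that its reflection
makes negative; that letter can be dropped.\<close>

lemma exchange:
  assumes "set as \<subseteq> \<Delta>" "a \<in> \<Delta>" "nonneg (- foldr reflection as a)"
  shows "\<exists>bs. set bs \<subseteq> \<Delta> \<and> Suc (length bs) = length as \<and>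
           (\<forall>x. foldr reflection as (reflection a x) = foldr reflection bs x)"
  using assms(1,3)
proof (induction as)
  case Nil
  then have "nonneg a" "nonneg (- a)" using assms(2) nonneg_base by auto
  then show ?case using nonneg_antisym root_nonzero base_subset assms(2) by blast
next
  case (Cons c as)
  let ?b = "foldr reflection as a"
  have b: "?b \<in> \<Phi>" using foldr_reflection_root Cons.prems assms(2) base_subset by auto
  show ?case
  proof (cases "nonneg (- ?b)")
    case True
    then obtain bs where "set bs \<subseteq> \<Delta>" "Suc (length bs) = length as"
      "\<And>x. foldr reflection as (reflection a x) = foldr reflection bs x"
      using Cons by auto
    then show ?thesis using Cons.prems by (intro exI[of _ "c # bs"]) auto
  next
    case False
    then have "nonneg ?b" using root_nonneg_cases b by blast
    have "?b = c"
    proof (rule ccontr)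
      assume "?b \<noteq> c"
      then have "nonneg (reflection c ?b)"
        using simple_reflection_nonneg Cons.prems \<open>nonneg ?b\<close> b by auto
      moreover have "nonneg (- reflection c ?b)" using Cons.prems by simp
      ultimately have "reflection c ?b = 0" using nonneg_antisym by blast
      moreover have "reflection c ?b \<in> \<Phi>"
        using reflection_root b Cons.prems base_subset by auto
      ultimately show False using root_nonzero by blast
    qed
    have "foldr reflection (c # as) (reflection a x) = foldr reflection as x" for x
      using reflection_conj[OF orthogonal_transformation_foldr_reflection, of as a x] \<open>?b = c\<close>
      by simp
    then show ?thesis using Cons.prems by (intro exI[of _ as]) auto
  qed
qed

lemma dominant_word_fixed:
  assumes "dominant x" "set as \<subseteq> \<Delta>" "dominant (foldr reflection as x)"
  shows "foldr reflection as x = x"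
  using assms(2,3)
proof (induction as rule: length_induct)
  case (1 as)
  show ?case
  proof (cases as rule: rev_cases)
    case Nil
    then show ?thesis by simp
  next
    case (snoc bs a)
    have a: "a \<in> \<Delta>" "a \<in> \<Phi>" and bs: "set bs \<subseteq> \<Delta>" using 1(2) snoc base_subset by auto
    let ?b = "foldr reflection bs a"
    have "?b \<in> \<Phi>" using foldr_reflection_root bs a by blast
    then consider "nonneg ?b" | "nonneg (- ?b)" using root_nonneg_cases by blast
    then show ?thesis
    proof cases
      case 1
      have w: "foldr reflection as a = - ?b"
        using snoc linear_neg[OF orthogonal_transformation_linear[OF
              orthogonal_transformation_foldr_reflection]]
        by simp
      have "0 \<le> ?b \<bullet> foldr reflection as x"
        using nonneg_inner_dominant 1 \<open>dominant (foldr reflection as x)\<close> by blast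
      also have "\<dots> = - (foldr reflection as a \<bullet> foldr reflection as x)"
        by (simp add: w)
      also have "\<dots> = - (a \<bullet> x)"
        using orthogonal_transformation_foldr_reflection[of as]
        by (simp add: orthogonal_transformation_def)
      finally have "a \<bullet> x = 0" using assms(1) a unfolding dominant_def by force
      then have "foldr reflection as x = foldr reflection bs x"
        by (simp add: snoc reflection_def inner_commute)
      moreover have "length bs < length as" using snoc by simp
      ultimately show ?thesis
        using "1.IH" bs \<open>dominant (foldr reflection as x)\<close> by force
    next
      case 2
      obtain cs where cs: "set cs \<subseteq> \<Delta>" "Suc (length cs) = length bs"
        "\<And>y. foldr reflection bs (reflection a y) = foldr reflection cs y"
        using exchange[OF bs a(1) 2] by blast
      then have "foldr reflection as x = foldr reflection cs x" by (simp add: snoc)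
      moreover have "length cs < length as" using snoc cs by simp
      ultimately show ?thesis
        using "1.IH" cs \<open>dominant (foldr reflection as x)\<close> by force
    qed
  qed
qed

text \<open>The height functional: \<open>\<delta> \<bullet> v\<close> is the sum of the simple root
  coefficients of \<open>v\<close>. It drives the inductions below.\<close>

definition \<delta> :: 'a where "\<delta> = (\<Sum>a\<in>\<Delta>. \<omega> a)"

lemma inner_\<delta>: "a \<in> \<Delta> \<Longrightarrow> \<delta> \<bullet> a = 1"
  using finite_base by (simp add: \<delta>_def inner_sum_left dual)

text \<open>Induction on the number of roots of smaller height. Some simple reflection lowers a
  positive root that is not simple, and conjugating by it relates the reflections of the two
  roots.\<close>

lemma reflection_word_nonneg:
  assumes "b \<in> \<Phi>" "nonneg b"
  shows "\<exists>as. set as \<subseteq> \<Delta> \<and> reflection b = foldr reflection as"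
  using assms
proof (induction "card {c \<in> \<Phi>. \<delta> \<bullet> c < \<delta> \<bullet> b}" arbitrary: b rule: less_induct)
  case less
  show ?case
  proof (cases "b \<in> \<Delta>")
    case True
    then show ?thesis by (intro exI[of _ "[b]"]) auto
  next
    case False
    have "\<exists>a\<in>\<Delta>. a \<bullet> b > 0"
    proof (rule ccontr)
      assume "\<not> ?thesis"
      then have "dominant (- b)" unfolding dominant_def by force
      then have "0 \<le> b \<bullet> (- b)" using nonneg_inner_dominant less.prems by blast
      then show False using root_nonzero[OF less.prems(1)]
        by (simp add: inner_gt_zero_iff flip: not_less)
    qed
    then obtain a where a: "a \<in> \<Delta>" "a \<bullet> b > 0" by blast
    let ?c = "reflection a b"
    have "a \<in> \<Phi>" using a base_subset by blast
    have c: "?c \<in> \<Phi>" "nonneg ?c"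
      using reflection_root simple_reflection_nonneg less.prems a False \<open>a \<in> \<Phi>\<close> by auto
    have "\<delta> \<bullet> ?c = \<delta> \<bullet> b - 2 * (b \<bullet> a) / (a \<bullet> a)"
      by (simp add: reflection_def inner_diff_right inner_\<delta> a)
    moreover have "a \<bullet> a > 0" using root_nonzero \<open>a \<in> \<Phi>\<close> by auto
    ultimately have lt: "\<delta> \<bullet> ?c < \<delta> \<bullet> b" using a by (simp add: inner_commute)
    have "card {d \<in> \<Phi>. \<delta> \<bullet> d < \<delta> \<bullet> ?c} < card {d \<in> \<Phi>. \<delta> \<bullet> d < \<delta> \<bullet> b}"
      using lt c(1) finite_roots by (intro psubset_card_mono) auto
    then obtain as where as: "set as \<subseteq> \<Delta>" "reflection ?c = foldr reflection as"
      using less.hyps c by blast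
    have "reflection b x = foldr reflection (a # as @ [a]) x" for x
      using reflection_conj[OF orthogonal_transformation_reflection, of a ?c "reflection a x"]
      by (simp flip: as(2))
    then show ?thesis using as a by (intro exI[of _ "a # as @ [a]"]) auto
  qed
qed

lemma weyl_group_word: "w \<in> weyl_group \<Phi> \<Longrightarrow> \<exists>as. set as \<subseteq> \<Delta> \<and> w = foldr reflection as"
proof (induction rule: weyl_group.induct)
  case id_in
  then show ?case by (intro exI[of _ "[]"]) auto
next
  case (refl_comp w b)
  have "\<exists>as. set as \<subseteq> \<Delta> \<and> reflection b = foldr reflection as"
  proof (cases "nonneg b")
    case True
    then show ?thesis using reflection_word_nonneg refl_comp by blast
  next
    case False
    then have "nonneg (- b)" using root_nonneg_cases refl_comp by blast
    moreover have "- b \<in> \<Phi>" using reflection_root[of b b] refl_comp by simp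
    ultimately show ?thesis using reflection_word_nonneg[of "- b"] by simp
  qed
  then obtain as bs where "set as \<subseteq> \<Delta>" "reflection b = foldr reflection as"
    "set bs \<subseteq> \<Delta>" "w = foldr reflection bs"
    using refl_comp by blast
  then show ?case by (intro exI[of _ "as @ bs"]) (auto simp: fun_eq_iff)
qed

lemma dominant_unique:
  assumes "dominant x" "w \<in> weyl_group \<Phi>" "dominant (w x)"
  shows "w x = x"
  using assms dominant_word_fixed weyl_group_word by blast

section \<open>Weyl orbits\<close>

lemma weyl_group_roots: "w \<in> weyl_group \<Phi> \<Longrightarrow> w ` \<Phi> = \<Phi>"
proof (induction rule: weyl_group.induct)
  case (refl_comp w a)
  then show ?case using image_comp[of "reflection a" w \<Phi>] reflection_roots by simp
qed simp

text \<open>Each element permutes the finitely many roots and, being linear, is determined by that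
  permutation since the roots span.\<close>

lemma finite_weyl_group: "finite (weyl_group \<Phi>)"
proof (rule finite_imageD)
  show "finite ((\<lambda>w. restrict w \<Phi>) ` weyl_group \<Phi>)"
  proof (rule finite_subset)
    show "(\<lambda>w. restrict w \<Phi>) ` weyl_group \<Phi> \<subseteq> \<Phi> \<rightarrow>\<^sub>E \<Phi>"
      using weyl_group_roots by fastforce
    show "finite (\<Phi> \<rightarrow>\<^sub>E \<Phi>)" using finite_roots by (simp add: finite_PiE)
  qed
  show "inj_on (\<lambda>w. restrict w \<Phi>) (weyl_group \<Phi>)"
  proof (rule inj_onI)
    fix u v assume uv: "u \<in> weyl_group \<Phi>" "v \<in> weyl_group \<Phi>" "restrict u \<Phi> = restrict v \<Phi>"
    then have "u x = v x" if "x \<in> \<Phi>" for x using that by (metis restrict_apply')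
    moreover have "linear u" "linear v"
      using uv weyl_group_orthogonal orthogonal_transformation_linear by blast+
    ultimately show "u = v" using span_roots linear_eq_on_span[of u v \<Phi>] by (auto simp: fun_eq_iff)
  qed
qed

definition orbit :: "'a \<Rightarrow> 'a set" where
  "orbit x = {w x | w. w \<in> weyl_group \<Phi>}"

lemma finite_orbit: "finite (orbit x)"
  using finite_weyl_group by (simp add: orbit_def)

lemma self_in_orbit: "x \<in> orbit x"
  unfolding orbit_def by (auto intro!: exI[of _ id] weyl_group.id_in)

lemma weyl_group_orbit:
  assumes "w \<in> weyl_group \<Phi>"
  shows "w ` orbit x = orbit x"
proof -
  have sub: "u ` orbit x \<subseteq> orbit x" if "u \<in> weyl_group \<Phi>" for u
  proof
    fix y assume "y \<in> u ` orbit x"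
    then obtain w where "w \<in> weyl_group \<Phi>" "y = (u \<circ> w) x" unfolding orbit_def by auto
    then show "y \<in> orbit x" using weyl_group_comp[OF that] unfolding orbit_def by blast
  qed
  obtain v where v: "v \<in> weyl_group \<Phi>" "w \<circ> v = id" using weyl_group_inverse[OF assms] by blast
  have "orbit x = w ` v ` orbit x" by (simp add: image_comp v(2))
  also have "\<dots> \<subseteq> w ` orbit x" using sub[OF v(1)] by blast
  finally show ?thesis using sub[OF assms] by blast
qed

lemma reflection_orbit: "a \<in> \<Delta> \<Longrightarrow> y \<in> orbit x \<Longrightarrow> reflection a y \<in> orbit x"
  using weyl_group_orbit[OF reflection_in_weyl_group] base_subset by blast

section \<open>Height and the climb to a dominant point\<close>

lemma base_norm_pos: "a \<in> \<Delta> \<Longrightarrow> a \<bullet> a > 0"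
  using root_nonzero base_subset by auto

lemma \<delta>_reflection_less:
  assumes "a \<in> \<Delta>" "a \<bullet> y < 0"
  shows "\<delta> \<bullet> y < \<delta> \<bullet> reflection a y"
  using assms base_norm_pos[OF assms(1)]
  by (simp add: reflection_def inner_diff_right inner_\<delta> inner_commute[of y] divide_neg_pos)

text \<open>A point of greatest height in the finite orbit is dominant, since otherwise a simple
  reflection would raise it.\<close>

lemma exists_dominant: "\<exists>w\<in>weyl_group \<Phi>. dominant (w x)"
proof -
  have "Max ((\<bullet>) \<delta> ` orbit x) \<in> (\<bullet>) \<delta> ` orbit x"
    using finite_orbit self_in_orbit[of x] by (intro Max_in) auto
  then obtain y where "y \<in> orbit x" "Max ((\<bullet>) \<delta> ` orbit x) = \<delta> \<bullet> y" by blast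
  then have y: "y \<in> orbit x" "\<delta> \<bullet> z \<le> \<delta> \<bullet> y" if "z \<in> orbit x" for z
    using that finite_orbit[of x] Max_ge[of "(\<bullet>) \<delta> ` orbit x" "\<delta> \<bullet> z"] by auto
  have "dominant y"
    unfolding dominant_def
  proof
    fix a assume "a \<in> \<Delta>"
    then have "\<delta> \<bullet> reflection a y \<le> \<delta> \<bullet> y" using y reflection_orbit self_in_orbit by blast
    then show "0 \<le> a \<bullet> y" using \<delta>_reflection_less[OF \<open>a \<in> \<Delta>\<close>, of y] by linarith
  qed
  then show ?thesis using y(1)[OF self_in_orbit] unfolding orbit_def by blast
qed

text \<open>A point that is not dominant is raised by a simple reflection; finiteness of the orbit
  ends the climb at a dominant point, which is \<open>x\<close> by uniqueness.\<close>

lemma orbit_ascent_induct: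
  assumes "dominant x" "y \<in> orbit x" and base: "P x"
    and step: "\<And>y a. y \<in> orbit x \<Longrightarrow> a \<in> \<Delta> \<Longrightarrow> a \<bullet> y < 0 \<Longrightarrow> P (reflection a y) \<Longrightarrow> P y"
  shows "P y"
  using assms(2)
proof (induction "card {z \<in> orbit x. \<delta> \<bullet> y < \<delta> \<bullet> z}" arbitrary: y rule: less_induct)
  case less
  show ?case
  proof (cases "dominant y")
    case True
    then have "y = x" using dominant_unique assms(1) less.prems unfolding orbit_def by blast
    then show ?thesis using base by simp
  next
    case False
    then obtain a where a: "a \<in> \<Delta>" "a \<bullet> y < 0" unfolding dominant_def by force
    have "card {z \<in> orbit x. \<delta> \<bullet> reflection a y < \<delta> \<bullet> z} < card {z \<in> orbit x. \<delta> \<bullet> y < \<delta> \<bullet> z}"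
      using \<delta>_reflection_less[OF a] reflection_orbit[OF a(1) less.prems] finite_orbit
      by (intro psubset_card_mono) auto
    then show ?thesis using less step a reflection_orbit by blast
  qed
qed

lemma dual_diff_reflection:
  assumes "a \<in> \<Delta>" "c \<in> \<Delta>"
  shows "\<omega> c \<bullet> (x - reflection a y) =
    \<omega> c \<bullet> (x - y) + (if c = a then 2 * (a \<bullet> y) / (a \<bullet> a) else 0)"
  using assms by (simp add: reflection_def inner_diff_right dual inner_commute[of y])

text \<open>Undoing a step of the climb to \<open>x\<close> subtracts a positive multiple of a
  simple root, so the deficit from \<open>x\<close> only grows.\<close>

lemma orbit_below_dominant:
  assumes "dominant x" "y \<in> orbit x"
  shows "nonneg (x - y)"
proof (rule orbit_ascent_induct[OF assms])
  show "nonneg (x - x)" by (simp add: nonneg_def)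
next
  fix y a assume "a \<in> \<Delta>" "a \<bullet> y < 0" "nonneg (x - reflection a y)"
  moreover have "2 * (a \<bullet> y) / (a \<bullet> a) < 0"
    using base_norm_pos[OF \<open>a \<in> \<Delta>\<close>] \<open>a \<bullet> y < 0\<close> by (simp add: divide_neg_pos)
  ultimately show "nonneg (x - y)"
    unfolding nonneg_def
  proof (intro ballI)
    fix c assume "c \<in> \<Delta>"
    assume "\<forall>c\<in>\<Delta>. 0 \<le> \<omega> c \<bullet> (x - reflection a y)"
    then have "0 \<le> \<omega> c \<bullet> (x - reflection a y)" using \<open>c \<in> \<Delta>\<close> by blast
    then show "0 \<le> \<omega> c \<bullet> (x - y)"
      using \<open>2 * (a \<bullet> y) / (a \<bullet> a) < 0\<close>
      unfolding dual_diff_reflection[OF \<open>a \<in> \<Delta>\<close> \<open>c \<in> \<Delta>\<close>] by (simp split: if_splits)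
  qed
qed

end

section \<open>Connected subdiagrams\<close>

definition induced_adj :: "'a::euclidean_space \<Rightarrow> 'a set \<Rightarrow> 'a option \<Rightarrow> 'a option \<Rightarrow> bool" where
  "induced_adj lam J u v \<longleftrightarrow>
     u \<in> insert None (Some ` J) \<and> v \<in> insert None (Some ` J) \<and> ext_adj lam u v"

lemma ext_adj_sym: "ext_adj lam u v \<Longrightarrow> ext_adj lam v u"
  by (cases u; cases v) (auto simp: inner_commute)

lemma induced_adj_sym: "(induced_adj lam J)\<^sup>*\<^sup>* u v \<Longrightarrow> (induced_adj lam J)\<^sup>*\<^sup>* v u"
  by (induction rule: rtranclp_induct)
    (auto simp: induced_adj_def intro: ext_adj_sym converse_rtranclp_into_rtranclp)

text \<open>Adjacency is symmetric, so connectedness reduces to reachability from the extended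
  node.\<close>

lemma connected_subdiagram_iff:
  "connected_subdiagram lam (insert None (Some ` J)) \<longleftrightarrow>
     (\<forall>a\<in>J. (induced_adj lam J)\<^sup>*\<^sup>* None (Some a))"
proof -
  have "(\<lambda>u v. u \<in> insert None (Some ` J) \<and> v \<in> insert None (Some ` J) \<and> ext_adj lam u v)
      = induced_adj lam J"
    by (simp add: induced_adj_def fun_eq_iff)
  then have "connected_subdiagram lam (insert None (Some ` J)) \<longleftrightarrow>
     (\<forall>u\<in>insert None (Some ` J). \<forall>v\<in>insert None (Some ` J). (induced_adj lam J)\<^sup>*\<^sup>* u v)"
    by (simp add: connected_subdiagram_def)
  moreover have "(induced_adj lam J)\<^sup>*\<^sup>* u v"
    if "(induced_adj lam J)\<^sup>*\<^sup>* None u" "(induced_adj lam J)\<^sup>*\<^sup>* None v" for u v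
    using that induced_adj_sym rtranclp_trans by metis
  ultimately show ?thesis by auto
qed

definition component :: "'a::euclidean_space \<Rightarrow> 'a set \<Rightarrow> 'a set" where
  "component lam J = {a \<in> J. (induced_adj lam J)\<^sup>*\<^sup>* None (Some a)}"

lemma component_neighbour:
  assumes "a \<in> J" and "v = None \<or> v \<in> Some ` component lam J" and "ext_adj lam v (Some a)"
  shows "a \<in> component lam J"
proof -
  have "(induced_adj lam J)\<^sup>*\<^sup>* None v" using assms(2) by (auto simp: component_def)
  moreover have "induced_adj lam J v (Some a)"
    using assms by (auto simp: induced_adj_def component_def)
  ultimately show ?thesis using assms(1) by (auto simp: component_def intro: rtranclp.rtrancl_into_rtrancl)
qed

text \<open>A path from the extended node inside \<open>J\<close> visits only vertices of the
  component, so it is also a path inside the component.\<close>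

lemma connected_component: "connected_subdiagram lam (insert None (Some ` component lam J))"
proof -
  have "(v = None \<or> v \<in> Some ` component lam J) \<and> (induced_adj lam (component lam J))\<^sup>*\<^sup>* None v"
    if "(induced_adj lam J)\<^sup>*\<^sup>* None v" for v
    using that
  proof (induction rule: rtranclp_induct)
    case base
    then show ?case by simp
  next
    case (step u v)
    have v: "v = None \<or> v \<in> Some ` component lam J"
    proof (cases v)
      case (Some a)
      then have "a \<in> J" using step(2) by (auto simp: induced_adj_def)
      moreover have "(induced_adj lam J)\<^sup>*\<^sup>* None v" using step(1,2) by simp
      ultimately show ?thesis using Some by (simp add: component_def)
    qed simp
    then have "induced_adj lam (component lam J) u v"
      using step by (auto simp: induced_adj_def)
    then show ?case using v step.IH by (auto intro: rtranclp.rtrancl_into_rtrancl)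
  qed
  then show ?thesis unfolding connected_subdiagram_iff by (auto simp: component_def)
qed

section \<open>Faces of the weight polytope\<close>

locale weighted_root_system = based_root_system +
  fixes lam :: 'a
  assumes lam_dominant: "dominant lam"
begin

abbreviation P :: "'a set" where "P \<equiv> weight_polytope \<Phi> lam"

lemma P_eq: "P = convex hull orbit lam"
  by (simp add: weight_polytope_def orbit_def)

lemma orbit_subset_P: "orbit lam \<subseteq> P"
  by (simp add: P_eq hull_subset)

lemma convex_P: "convex P"
  by (simp add: P_eq)

lemma weyl_group_P: "w \<in> weyl_group \<Phi> \<Longrightarrow> w ` P = P"
  unfolding P_eq
  by (metis convex_hull_linear_image orthogonal_transformation_linear weyl_group_orbit
      weyl_group_orthogonal)

lemma P_below: "x \<in> P \<Longrightarrow> nonneg (lam - x)"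
proof -
  have "convex (\<Inter>a\<in>\<Delta>. {x. \<omega> a \<bullet> x \<le> \<omega> a \<bullet> lam})"
    by (intro convex_INT ballI convex_halfspace_le)
  moreover have "(\<Inter>a\<in>\<Delta>. {x. \<omega> a \<bullet> x \<le> \<omega> a \<bullet> lam}) = {x. nonneg (lam - x)}"
    by (auto simp: nonneg_def inner_diff_right)
  ultimately have "P \<subseteq> {x. nonneg (lam - x)}"
    unfolding P_eq using orbit_below_dominant[OF lam_dominant] by (intro hull_minimal) auto
  then show "x \<in> P \<Longrightarrow> nonneg (lam - x)" by blast
qed

text \<open>For \<open>J\<close> within \<open>\<Delta>\<close> this is the intersection of
  \<open>P\<close> with the translate of \<open>span J\<close> through \<open>lam\<close>, written
  in coefficients because a simple reflection changes just one of them.\<close>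

definition face :: "'a set \<Rightarrow> 'a set" where
  "face J = {x \<in> P. \<forall>a\<in>\<Delta> - J. \<omega> a \<bullet> (lam - x) = 0}"

lemma face_mono: "C \<subseteq> J \<Longrightarrow> face C \<subseteq> face J"
  unfolding face_def by blast

lemma lam_in_face: "lam \<in> face J"
  using orbit_subset_P self_in_orbit by (auto simp: face_def)

text \<open>\<open>(lam - x) \<bullet> \<mu>\<close> is a sum of nonnegative terms, one for each
  simple root, so it vanishes only if all of them do.\<close>

lemma face_eq_supporting:
  assumes "dominant \<mu>"
  shows "face {a \<in> \<Delta>. a \<bullet> \<mu> = 0} = P \<inter> {x. \<mu> \<bullet> x = \<mu> \<bullet> lam}"
proof -
  have "(\<forall>a\<in>\<Delta> - {a \<in> \<Delta>. a \<bullet> \<mu> = 0}. \<omega> a \<bullet> (lam - x) = 0) \<longleftrightarrow> \<mu> \<bullet> x = \<mu> \<bullet> lam" if "x \<in> P" for x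
  proof -
    have "(lam - x) \<bullet> \<mu> = 0 \<longleftrightarrow> (\<forall>a\<in>\<Delta>. (\<omega> a \<bullet> (lam - x)) * (a \<bullet> \<mu>) = 0)"
      using P_below[OF that] assms finite_base
      by (subst inner_expansion, subst sum_nonneg_eq_0_iff) (auto simp: nonneg_def dominant_def)
    moreover have "(lam - x) \<bullet> \<mu> = 0 \<longleftrightarrow> \<mu> \<bullet> x = \<mu> \<bullet> lam"
      by (auto simp: inner_diff_left inner_diff_right inner_commute)
    ultimately show ?thesis by auto
  qed
  then show ?thesis unfolding face_def by blast
qed

lemma P_below_inner: "dominant \<mu> \<Longrightarrow> x \<in> P \<Longrightarrow> \<mu> \<bullet> x \<le> \<mu> \<bullet> lam"
  using nonneg_inner_dominant[OF P_below, of x \<mu>] by (simp add: inner_diff_left inner_diff_right inner_commute)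

lemma face_face_of:
  assumes "J \<subseteq> \<Delta>"
  shows "face J face_of P"
proof -
  \<comment> \<open>This functional is 0 on \<open>J\<close> and 1 on the other simple roots, hence
    dominant.\<close>
  define \<mu> where "\<mu> = (\<Sum>a\<in>\<Delta> - J. \<omega> a)"
  have \<mu>: "b \<bullet> \<mu> = (if b \<in> J then 0 else 1)" if "b \<in> \<Delta>" for b
  proof -
    have "b \<bullet> \<mu> = (\<Sum>a\<in>\<Delta> - J. if b = a then 1 else 0)"
      unfolding \<mu>_def inner_sum_right using that dual
      by (intro sum.cong) (auto simp: inner_commute[of b])
    then show ?thesis using that finite_base by simp
  qed
  then have "dominant \<mu>" "{a \<in> \<Delta>. a \<bullet> \<mu> = 0} = J"
    using assms by (auto simp: dominant_def split: if_splits)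
  then have "face J = P \<inter> {x. \<mu> \<bullet> x = \<mu> \<bullet> lam}"
    using face_eq_supporting by blast
  moreover have "\<dots> face_of P"
    using P_below_inner \<open>dominant \<mu>\<close> by (intro face_of_Int_supporting_hyperplane_le convex_P) auto
  ultimately show ?thesis by simp
qed

text \<open>Faces of a polytope are exposed. A Weyl group element makes the normal vector dominant
  and preserves \<open>P\<close>, so the image is cut out by a dominant functional.\<close>

lemma face_conjugate:
  assumes "F face_of P" "F \<noteq> {}"
  shows "\<exists>w\<in>weyl_group \<Phi>. \<exists>J\<subseteq>\<Delta>. w ` F = face J"
proof -
  have "polyhedron P"
    unfolding P_eq by (intro polytope_imp_polyhedron polytope_convex_hull finite_orbit)
  then have "F exposed_face_of P" using assms(1) exposed_face_of_polyhedron by blast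
  then obtain a b where ab: "P \<subseteq> {x. a \<bullet> x \<le> b}" "F = P \<inter> {x. a \<bullet> x = b}"
    unfolding exposed_face_of_def by blast
  obtain w where w: "w \<in> weyl_group \<Phi>" "dominant (w a)" using exists_dominant by blast
  have inner: "w a \<bullet> w x = a \<bullet> x" for x
    using weyl_group_orthogonal[OF w(1)] by (simp add: orthogonal_transformation_def)
  have "w ` F = w ` P \<inter> {x. w a \<bullet> x = b}"
    unfolding ab(2) using inner by (auto simp: image_iff)
  then have "w ` F = P \<inter> {x. w a \<bullet> x = b}"
    using weyl_group_P[OF w(1)] by simp
  \<comment> \<open>A point of \<open>F\<close> shows that the bound \<open>b\<close> is attained on
    \<open>P\<close>, and a dominant functional is greatest on \<open>P\<close> at
    \<open>lam\<close>.\<close>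
  moreover have "w a \<bullet> lam = b"
  proof (rule antisym)
    obtain x where "x \<in> P" "lam = w x"
      using weyl_group_P[OF w(1)] orbit_subset_P self_in_orbit[of lam] by blast
    then show "w a \<bullet> lam \<le> b" using ab inner by auto
    obtain y where "y \<in> F" using assms(2) by blast
    then have "y \<in> P" "w a \<bullet> w y = b" using ab inner by auto
    then have "w y \<in> P" using weyl_group_P[OF w(1)] by blast
    then show "b \<le> w a \<bullet> lam" using P_below_inner[OF w(2)] \<open>w a \<bullet> w y = b\<close> by force
  qed
  ultimately have "w ` F = face {c \<in> \<Delta>. c \<bullet> w a = 0}" using face_eq_supporting[OF w(2)] by simp
  moreover have "{c \<in> \<Delta>. c \<bullet> w a = 0} \<subseteq> \<Delta>" by simp
  ultimately show ?thesis using w(1) by blast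
qed

text \<open>A face of the hull of the finite orbit is itself the hull of orbit points, so comparing
  orbit points suffices.\<close>

lemma face_eqI:
  assumes "C \<subseteq> J" "J \<subseteq> \<Delta>" "orbit lam \<inter> face J \<subseteq> face C"
  shows "face J = face C"
proof
  have "face J face_of convex hull orbit lam" using face_face_of assms(2) P_eq by simp
  then obtain S where S: "S \<subseteq> orbit lam" "face J = convex hull S"
    using face_of_convex_hull_subset finite_imp_compact[OF finite_orbit] by metis
  then have "S \<subseteq> face C" using assms(3) hull_subset[of S convex] by auto
  moreover have "convex (face C)" using face_face_of assms face_of_imp_convex by blast
  ultimately show "face J \<subseteq> face C" unfolding S(2) by (rule hull_minimal)
qed (rule face_mono[OF assms(1)])

lemma face_component:
  assumes "J \<subseteq> \<Delta>"
  shows "face J = face (component lam J)"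
proof (rule face_eqI[OF _ assms])
  let ?C = "component lam J"
  show CJ: "?C \<subseteq> J" by (auto simp: component_def)
  have "y \<in> face J \<longrightarrow> y \<in> face ?C" if "y \<in> orbit lam" for y
  proof (rule orbit_ascent_induct[OF lam_dominant that])
    show "lam \<in> face J \<longrightarrow> lam \<in> face ?C" by (simp add: lam_in_face)
  next
    fix y a assume y: "y \<in> orbit lam" and a: "a \<in> \<Delta>" "a \<bullet> y < 0"
      and IH: "reflection a y \<in> face J \<longrightarrow> reflection a y \<in> face ?C"
    let ?z = "reflection a y"
    have z: "?z \<in> orbit lam" using reflection_orbit a y by blast
    have neg: "2 * (a \<bullet> y) / (a \<bullet> a) < 0"
      using a base_norm_pos by (simp add: divide_neg_pos)
    show "y \<in> face J \<longrightarrow> y \<in> face ?C"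
    proof
      assume yJ: "y \<in> face J"
      have "0 \<le> \<omega> a \<bullet> (lam - ?z)"
        using P_below orbit_subset_P z a unfolding nonneg_def by blast
      \<comment> \<open>The step up strictly lowers the deficit at \<open>a\<close>, which stays
        nonnegative; so \<open>y\<close> had a positive deficit there, which \<open>face J\<close>
        allows only for \<open>a\<close> in \<open>J\<close>.\<close>
      then have aJ: "a \<in> J"
        using yJ a neg by (cases "a \<in> J") (auto simp: face_def dual_diff_reflection)
      then have "?z \<in> face J"
        using yJ a z orbit_subset_P by (auto simp: face_def dual_diff_reflection)
      then have zC: "?z \<in> face ?C" using IH by blast
      have az: "a \<bullet> ?z > 0"
        using a reflection_inner_swap[of a y a] by (simp add: inner_commute)
      have "a \<in> ?C"
      proof (rule ccontr)
        assume aC: "a \<notin> ?C"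
        \<comment> \<open>Outside the component, \<open>a\<close> would be orthogonal to all roots
          carrying the deficit \<open>lam - ?z\<close>. Then \<open>lam \<bullet> a\<close> equals
          \<open>a \<bullet> ?z\<close>, which is positive, so \<open>a\<close> would be a neighbour
          of the extended node.\<close>
        have "(\<omega> c \<bullet> (lam - ?z)) * (c \<bullet> a) = 0" if "c \<in> \<Delta>" for c
        proof (cases "c \<in> ?C")
          case True
          then have "c \<bullet> a = 0"
            using component_neighbour[OF aJ, of "Some c" lam] aC by auto
          then show ?thesis by simp
        next
          case False
          then show ?thesis using zC that by (simp add: face_def)
        qed
        then have "(lam - ?z) \<bullet> a = 0" by (subst inner_expansion) (simp add: sum.neutral)
        then have "lam \<bullet> a > 0" using az by (simp add: inner_diff_left inner_diff_right inner_commute)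
        then show False using component_neighbour[OF aJ, of None lam] aC by simp
      qed
      then show "y \<in> face ?C"
        using zC y orbit_subset_P a unfolding face_def
        by (auto simp: dual_diff_reflection split: if_splits)
    qed
  qed
  then show "orbit lam \<inter> face J \<subseteq> face ?C" by blast
qed

section \<open>Recovering the set of simple roots from its face\<close>

lemma reflection_face:
  assumes "a \<in> J" "J \<subseteq> \<Delta>" "y \<in> orbit lam \<inter> face J"
  shows "reflection a y \<in> orbit lam \<inter> face J"
proof -
  have "a \<in> \<Delta>" using assms by blast
  then have "reflection a y \<in> orbit lam" using reflection_orbit assms by blast
  then show ?thesis
    using assms \<open>a \<in> \<Delta>\<close> orbit_subset_P unfolding face_def by (auto simp: dual_diff_reflection)
qed

text \<open>Positive deficits spread along a path from the extended node: every root reached gets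
  its own orbit point of the face.\<close>

lemma full_support:
  assumes "J \<subseteq> \<Delta>" "connected_subdiagram lam (insert None (Some ` J))" "a \<in> J"
  shows "\<exists>y\<in>orbit lam \<inter> face J. 0 < \<omega> a \<bullet> (lam - y)"
proof -
  \<comment> \<open>When \<open>0 < a \<bullet> y\<close>, the reflection moves \<open>y\<close>
    down along \<open>a\<close>, and a nonnegative deficit becomes positive.\<close>
  have ref: "0 < \<omega> a \<bullet> (lam - reflection a y)"
    if "y \<in> orbit lam \<inter> face J" "a \<in> J" "0 < a \<bullet> y" for a y
  proof -
    have a: "a \<in> \<Delta>" using assms that by blast
    then have "0 \<le> \<omega> a \<bullet> (lam - y)"
      using P_below orbit_subset_P that unfolding nonneg_def by blast
    then show ?thesis using that(3) base_norm_pos[OF a]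
      by (simp add: dual_diff_reflection a add_nonneg_pos)
  qed
  have "case v of None \<Rightarrow> True | Some a \<Rightarrow> \<exists>y\<in>orbit lam \<inter> face J. 0 < \<omega> a \<bullet> (lam - y)"
    if "(induced_adj lam J)\<^sup>*\<^sup>* None v" for v
    using that
  proof (induction rule: rtranclp_induct)
    case base
    then show ?case by simp
  next
    case (step u v)
    show ?case
    proof (cases v)
      case None
      then show ?thesis by simp
    next
      case (Some a)
      then have aJ: "a \<in> J" using step(2) by (auto simp: induced_adj_def)
      have "\<exists>y\<in>orbit lam \<inter> face J. 0 < \<omega> a \<bullet> (lam - y) \<or> 0 < a \<bullet> y"
      proof (cases u)
        case None
        then have "0 < a \<bullet> lam"
          using step(2) Some by (simp add: induced_adj_def inner_commute)
        then show ?thesis using lam_in_face self_in_orbit by blast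
      next
        case u: (Some b)
        then have b: "b \<in> J" "b \<noteq> a" "b \<bullet> a \<noteq> 0"
          using step(2) Some by (auto simp: induced_adj_def)
        obtain y where y: "y \<in> orbit lam \<inter> face J" "0 < \<omega> b \<bullet> (lam - y)"
          using step.IH u by auto
        have ab: "a \<in> \<Delta>" "b \<in> \<Delta>" using assms(1) aJ b by auto
        have nn: "nonneg (lam - y)" using P_below orbit_subset_P y by blast
        \<comment> \<open>With no deficit at \<open>a\<close> itself, obtuseness makes all terms of
          \<open>(lam - y) \<bullet> a\<close> nonpositive, and the deficit at the neighbour
          \<open>b\<close> makes one negative. Hence \<open>a \<bullet> y\<close> exceeds
          \<open>a \<bullet> lam\<close>.\<close>
        have "0 < a \<bullet> y" if "\<omega> a \<bullet> (lam - y) = 0"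
        proof -
          have "(lam - y) \<bullet> a = (\<Sum>c\<in>\<Delta>. (\<omega> c \<bullet> (lam - y)) * (c \<bullet> a))" by (rule inner_expansion)
          also have "\<dots> < (\<Sum>c\<in>\<Delta>. 0)"
          proof (rule sum_strict_mono_ex1[OF finite_base])
            show "\<forall>c\<in>\<Delta>. (\<omega> c \<bullet> (lam - y)) * (c \<bullet> a) \<le> 0"
            proof
              fix c assume "c \<in> \<Delta>"
              then show "(\<omega> c \<bullet> (lam - y)) * (c \<bullet> a) \<le> 0"
                using that nn base_obtuse[of c a] ab
                by (cases "c = a") (auto simp: nonneg_def mult_nonneg_nonpos)
            qed
            have "b \<bullet> a < 0" using base_obtuse[of b a] ab b by force
            then show "\<exists>c\<in>\<Delta>. (\<omega> c \<bullet> (lam - y)) * (c \<bullet> a) < 0"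
              using y ab mult_pos_neg by blast
          qed
          finally have "(lam - y) \<bullet> a < 0" by simp
          moreover have "0 \<le> a \<bullet> lam" using lam_dominant ab unfolding dominant_def by blast
          ultimately show ?thesis by (simp add: inner_diff_left inner_diff_right inner_commute)
        qed
        then show ?thesis using y nn ab unfolding nonneg_def by force
      qed
      then show ?thesis using ref aJ reflection_face[OF _ assms(1)] Some by fastforce
    qed
  qed
  moreover have "(induced_adj lam J)\<^sup>*\<^sup>* None (Some a)"
    using assms(2,3) unfolding connected_subdiagram_iff by blast
  ultimately show ?thesis by fastforce
qed

text \<open>A multiple of the barycentre of the orbit points in the face; Weyl group elements carry
  it along with the face.\<close>

definition vertex_sum :: "'a set \<Rightarrow> 'a" where
  "vertex_sum J = \<Sum>(orbit lam \<inter> face J)"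

text \<open>For \<open>a\<close> in \<open>J\<close> the reflection permutes the summands, so the
  sum is orthogonal to \<open>a\<close>. For \<open>a\<close> outside \<open>J\<close> the deficit
  of each summand \<open>y\<close> lies on roots at no acute angle to \<open>a\<close>, so
  \<open>a \<bullet> y\<close> is at least \<open>a \<bullet> lam\<close>.\<close>

lemma dominant_vertex_sum:
  assumes "J \<subseteq> \<Delta>"
  shows "dominant (vertex_sum J)"
  unfolding dominant_def
proof
  fix a assume a: "a \<in> \<Delta>"
  show "0 \<le> a \<bullet> vertex_sum J"
  proof (cases "a \<in> J")
    case True
    have "(\<Sum>y\<in>orbit lam \<inter> face J. a \<bullet> y) = (\<Sum>y\<in>orbit lam \<inter> face J. a \<bullet> reflection a y)"
      using reflection_face[OF True assms]
      by (intro sum.reindex_bij_witness[of _ "reflection a" "reflection a"]) auto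
    also have "\<dots> = - (\<Sum>y\<in>orbit lam \<inter> face J. a \<bullet> y)"
      by (simp add: reflection_inner_swap[symmetric] sum_negf)
    finally show ?thesis by (simp add: vertex_sum_def inner_sum_right)
  next
    case False
    have "0 \<le> a \<bullet> y" if y: "y \<in> orbit lam \<inter> face J" for y
    proof -
      have "(\<omega> c \<bullet> (lam - y)) * (c \<bullet> a) \<le> 0" if "c \<in> \<Delta>" for c
      proof (cases "c \<in> J")
        case True
        then show ?thesis
          using that a False y base_obtuse[of c a] P_below[of y] orbit_subset_P
          by (auto simp: nonneg_def intro!: mult_nonneg_nonpos)
      next
        case False
        then show ?thesis using y that by (simp add: face_def)
      qed
      then have "(lam - y) \<bullet> a \<le> 0" by (subst inner_expansion) (simp add: sum_nonpos)
      moreover have "0 \<le> a \<bullet> lam" using lam_dominant a unfolding dominant_def by blast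
      ultimately show ?thesis by (simp add: inner_diff_left inner_diff_right inner_commute)
    qed
    then show ?thesis unfolding vertex_sum_def inner_sum_right by (rule sum_nonneg)
  qed
qed

lemma vertex_sum_deficit:
  "\<omega> a \<bullet> (real (card (orbit lam \<inter> face J)) *\<^sub>R lam - vertex_sum J)
     = (\<Sum>y\<in>orbit lam \<inter> face J. \<omega> a \<bullet> (lam - y))"
  by (simp add: vertex_sum_def inner_diff_right inner_sum_right sum_subtractf)

text \<open>Deficits are nonnegative and cannot cancel: at a root of \<open>J\<close> some summand
  is positive by \<open>full_support\<close>, and outside \<open>J\<close> all vanish.\<close>

lemma vertex_sum_support:
  assumes "J \<subseteq> \<Delta>" "connected_subdiagram lam (insert None (Some ` J))"
  shows "J = {a \<in> \<Delta>. \<omega> a \<bullet> (real (card (orbit lam \<inter> face J)) *\<^sub>R lam - vertex_sum J) \<noteq> 0}"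
proof -
  have "(\<Sum>y\<in>orbit lam \<inter> face J. \<omega> a \<bullet> (lam - y)) \<noteq> 0 \<longleftrightarrow> a \<in> J" if a: "a \<in> \<Delta>" for a
  proof
    assume "a \<in> J"
    then obtain y where "y \<in> orbit lam \<inter> face J" "0 < \<omega> a \<bullet> (lam - y)"
      using full_support[OF assms] by blast
    moreover have "0 \<le> \<omega> a \<bullet> (lam - y)" if "y \<in> orbit lam \<inter> face J" for y
      using that a P_below orbit_subset_P unfolding nonneg_def by blast
    ultimately have "0 < (\<Sum>y\<in>orbit lam \<inter> face J. \<omega> a \<bullet> (lam - y))"
      using finite_orbit by (intro sum_pos2) auto
    then show "(\<Sum>y\<in>orbit lam \<inter> face J. \<omega> a \<bullet> (lam - y)) \<noteq> 0" by simp
  next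
    assume "(\<Sum>y\<in>orbit lam \<inter> face J. \<omega> a \<bullet> (lam - y)) \<noteq> 0"
    then obtain y where "y \<in> face J" "\<omega> a \<bullet> (lam - y) \<noteq> 0"
      using sum.not_neutral_contains_not_neutral by blast
    then show "a \<in> J" using a unfolding face_def by blast
  qed
  then show ?thesis using assms(1) vertex_sum_deficit by auto
qed

text \<open>\<open>w\<close> maps the orbit points of one face onto those of the other, so the two
  vertex sums are conjugate and dominant, hence equal. The numbers of points agree too, so
  \<open>J\<close> and \<open>K\<close> are the support of the same deficit.\<close>

lemma face_conjugate_unique:
  assumes "J \<subseteq> \<Delta>" "connected_subdiagram lam (insert None (Some ` J))"
    and "K \<subseteq> \<Delta>" "connected_subdiagram lam (insert None (Some ` K))"
    and w: "w \<in> weyl_group \<Phi>" "w ` face J = face K"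
  shows "J = K"
proof -
  have orth: "orthogonal_transformation w" using weyl_group_orthogonal w by blast
  then have inj: "inj w" and lin: "linear w"
    using orthogonal_transformation_inj orthogonal_transformation_linear by blast+
  have img: "w ` (orbit lam \<inter> face J) = orbit lam \<inter> face K"
    using image_Int[OF inj] weyl_group_orbit[OF w(1)] w(2) by simp
  have "card (orbit lam \<inter> face K) = card (orbit lam \<inter> face J)"
    using card_image[OF inj_on_subset[OF inj]] img by (metis top_greatest)
  moreover have "w (vertex_sum J) = vertex_sum K"
    unfolding vertex_sum_def img[symmetric]
    using inj_on_subset[OF inj] by (simp add: linear_sum[OF lin] sum.reindex)
  then have "vertex_sum K = vertex_sum J"
    using dominant_unique[of "vertex_sum J" w] dominant_vertex_sum assms by metis
  ultimately show ?thesis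
    using vertex_sum_support[OF assms(1,2)] vertex_sum_support[OF assms(3,4)] by simp
qed

section \<open>The bijection between subdiagrams and orbits of faces\<close>

lemma weyl_orbit_image_eq:
  assumes "w \<in> weyl_group \<Phi>"
  shows "{u ` w ` F | u. u \<in> weyl_group \<Phi>} = {u ` F | u. u \<in> weyl_group \<Phi>}"
proof -
  obtain v where v: "v \<in> weyl_group \<Phi>" "v \<circ> w = id" using weyl_group_inverse[OF assms] by blast
  show ?thesis
  proof (intro set_eqI iffI; clarify)
    fix u assume u: "u \<in> weyl_group \<Phi>"
    have "u ` w ` F = (u \<circ> w) ` F" by (rule image_comp)
    then show "\<exists>t. u ` w ` F = t ` F \<and> t \<in> weyl_group \<Phi>"
      using weyl_group_comp[OF u assms] by blast
    have "u ` F = u ` (v \<circ> w) ` F" by (simp add: v(2) del: image_comp)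
    then have "u ` F = (u \<circ> v) ` w ` F" by (simp add: image_comp comp_assoc)
    then show "\<exists>t. u ` F = t ` w ` F \<and> t \<in> weyl_group \<Phi>"
      using weyl_group_comp[OF u v(1)] by blast
  qed
qed

text \<open>In this direction the map needs no choice of representatives, since a subdiagram names
  an explicit face. The preimage under \<open>Some\<close> drops the extended node.\<close>

lemma bij_betw_subdiagrams_face_orbits:
  "bij_betw (\<lambda>S. {w ` face (Some -` S) | w. w \<in> weyl_group \<Phi>})
     (ext_subdiagrams \<Delta> lam) (face_orbits \<Phi> lam)"
  (is "bij_betw ?h ?A ?B")
proof (rule bij_betw_imageI)
  have S: "S = insert None (Some ` (Some -` S))" "Some -` S \<subseteq> \<Delta>"
    "connected_subdiagram lam (insert None (Some ` (Some -` S)))" if "S \<in> ?A" for S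
  proof -
    show "S = insert None (Some ` (Some -` S))" "Some -` S \<subseteq> \<Delta>"
      using that by (auto simp: ext_subdiagrams_def ext_vertices_def)
    then show "connected_subdiagram lam (insert None (Some ` (Some -` S)))"
      using that by (simp add: ext_subdiagrams_def)
  qed
  show "inj_on ?h ?A"
  proof (rule inj_onI)
    fix S T assume ST: "S \<in> ?A" "T \<in> ?A" "?h S = ?h T"
    have "face (Some -` T) \<in> ?h T" by (auto intro!: exI[of _ id] weyl_group.id_in)
    then have "face (Some -` T) \<in> ?h S" by (simp only: ST(3))
    then obtain w where "w \<in> weyl_group \<Phi>" "w ` face (Some -` S) = face (Some -` T)"
      by auto
    then have "Some -` S = Some -` T"
      using face_conjugate_unique[OF S(2,3)[OF ST(1)] S(2,3)[OF ST(2)]] by blast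
    then show "S = T" using S(1)[OF ST(1)] S(1)[OF ST(2)] by simp
  qed
  show "?h ` ?A = ?B"
  proof
    show "?h ` ?A \<subseteq> ?B"
    proof
      fix X assume "X \<in> ?h ` ?A"
      then obtain S where "S \<in> ?A" "X = ?h S" by blast
      moreover have "face (Some -` S) face_of P" "face (Some -` S) \<noteq> {}"
        using face_face_of S(2) lam_in_face \<open>S \<in> ?A\<close> by blast+
      ultimately show "X \<in> ?B" unfolding face_orbits_def by blast
    qed
    show "?B \<subseteq> ?h ` ?A"
    proof
      fix X assume "X \<in> ?B"
      then obtain F where F: "F face_of P" "F \<noteq> {}" "X = {w ` F | w. w \<in> weyl_group \<Phi>}"
        unfolding face_orbits_def by blast
      obtain w J where w: "w \<in> weyl_group \<Phi>" "J \<subseteq> \<Delta>" "w ` F = face J"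
        using face_conjugate F by blast
      \<comment> \<open>\<open>J\<close> need not give a connected subdiagram, but its component
        defines the same face.\<close>
      let ?S = "insert None (Some ` component lam J)"
      have "?S \<in> ?A"
        using connected_component[of lam J] w(2)
        by (auto simp: ext_subdiagrams_def ext_vertices_def component_def)
      moreover have "Some -` ?S = component lam J" by auto
      then have "?h ?S = X"
        using weyl_orbit_image_eq[OF w(1), of F] face_component[OF w(2)] F(3) w(3) by simp
      ultimately show "X \<in> ?h ` ?A" by blast
    qed
  qed
qed

end

theorem theoremD:
  fixes \<Phi> \<Delta> :: "'a::euclidean_space set" and lam :: 'a
  assumes "irreducible_root_system \<Phi>"
    and "is_base \<Phi> \<Delta>"
    and "dominant_integral \<Delta> lam"
  shows "\<exists>f. bij_betw f (face_orbits \<Phi> lam) (ext_subdiagrams \<Delta> lam)"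
proof -
  have roots: "root_system \<Phi>" using assms(1) by (simp add: irreducible_root_system_def)
  have "independent \<Delta>" "span \<Delta> = UNIV"
  proof -
    show "independent \<Delta>" using assms(2) by (simp add: is_base_def)
    show "span \<Delta> = UNIV" using is_base_span roots assms(2) by blast
  qed
  then obtain \<omega> where \<omega>: "\<And>a b. a \<in> \<Delta> \<Longrightarrow> b \<in> \<Delta> \<Longrightarrow> \<omega> a \<bullet> b = (if a = b then 1 else 0)"
    using dual_basis_exists by blast
  interpret based_root_system \<Phi> \<Delta> \<omega>
    using roots assms(2) \<omega> by (rule based_root_system.intro)
  interpret weighted_root_system \<Phi> \<Delta> \<omega> lam
  proof unfold_locales
    have "0 \<le> a \<bullet> lam" if "a \<in> \<Delta>" for a
    proof -
      have "2 * (lam \<bullet> a) / (a \<bullet> a) \<ge> 0"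
        using assms(3) that Nats_altdef2 unfolding dominant_integral_def by force
      then show ?thesis using base_norm_pos[OF that] by (simp add: zero_le_divide_iff inner_commute)
    qed
    then show "dominant lam" by (simp add: dominant_def)
  qed
  show ?thesis using bij_betw_inv_into[OF bij_betw_subdiagrams_face_orbits] by blast
qed

end
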